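(* For all $X,Y\in\mathcal D$, \[0\leq d_\tau(X,Y)\leq\frac{3d_{\mathrm{conc}}(X,Y)-d_{\mathrm{conc}}(X,Y)^2}{2}\leq1.\] On the other hand, there is no function $\omega\colon[0,1]\to[0,+\infty)$ such that $\omega(r)\to0$ as $r\to0$ and \[d_{\mathrm{conc}}(X,Y)\leq\omega(d_\tau(X,Y))\] for all $X,Y\in\mathcal D$.
   Context: A geometric data set is a triple $(X,F_X,\mu_X)$ where $F_X$ is a nonempty family of real-valued functions (features) on $X$ such that $d_X(x,x'):=\sup_{f\in F_X}|f(x)-f(x')|$ is a (finite) complete separable metric on $X$, and $\mu_X$ is a Borel probability measure on $(X,d_X)$ with full support. $\overline{F_X}$ denotes the closure of $F_X$ in the set of real-valued functions on $X$ under pointwise convergence. $X$ and $Y$ are isomorphic if there is a Borel map $\phi:X\to Y$ with $\phi_*\mu_X=\mu_Y$ and $\overline{F_Y}\circ\phi=\overline{F_X}$. Isomorphic geometric data sets are identified; $\mathcal D$ is the set of isomorphism classes. $\mathcal T(\mu,\nu)$ is the set of couplings of $\mu,\nu$ (Borel probability measures on the product with marginals $\mu,\nu$); $\mathrm{pr}_1,\mathrm{pr}_2$ are the coordinate projections; $(d)_H$ is the Hausdorff distance induced by $d$. Compactified observable distance. $\tau:\mathbb R\to(-1/2,1/2)$, $\tau(r)=\frac12\tanh r$. $\mathsf K_\tau(X)$ is the closure of $\{\tau\circ f\mid f\in F_X\}$ under pointwise convergence on $X$. With $d_{1,\pi}(u,v)=\int|u-v|\,d\pi$, set $D_\tau^\pi(X,Y):=(d_{1,\pi})_H(\mathsf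 K_\tau(X)\circ\mathrm{pr}_1,\mathsf K_\tau(Y)\circ\mathrm{pr}_2)$ for $\pi\in\mathcal T(\mu_X,\mu_Y)$ and $d_\tau(X,Y):=\inf_{\pi\in\mathcal T(\mu_X,\mu_Y)}D^\pi_\tau(X,Y)$. Observable distance. The Ky Fan metric on a probability space $(Z,\xi)$ is $d_{\mathrm{KF}}^\xi(u,v):=\inf\{\epsilon\ge0\mid\xi(\{|u-v|>\epsilon\})\le\epsilon\}$. A parameter of $\mu_X$ is a Borel map $\varphi:[0,1)\to X$ with $\varphi_*\lambda=\mu_X$, $\lambda$ being Lebesgue measure on $[0,1)$. Then $d_{\mathrm{conc}}(X,Y):=\inf_{\varphi,\psi}(d_{\mathrm{KF}}^\lambda)_H(F_X\circ\varphi,F_Y\circ\psi)$, where $\varphi,\psi$ range over the parameters of $\mu_X,\mu_Y$. *)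

theory Defs
  imports "HOL-Probability.Probability"
begin

text \<open>
  Features are real functions on the carrier, represented as functions that are
  \<^const>\<open>extensional\<close> on it, so that the topology of pointwise convergence is
  \<^const>\<open>product_topology\<close> over the carrier.

  Since a separable metric space has at most continuum many points, every isomorphism class of
  geometric data sets has a representative of type \<open>real data_set\<close> (transport along an
  injection of the carrier into \<open>\<real>\<close>); statements that quantify over all geometric
  data sets inside a formula can therefore use that type.
\<close>

record 'a data_set =
  pts :: "'a set"
  feats :: "('a \<Rightarrow> real) set"
  meas :: "'a measure"

text \<open>The value outside the carrier is fixed to 0 because \<^locale>\<open>Metric_space\<close> asks for
  symmetry and nonnegativity on the whole type.\<close>

definition feat_dist :: "'a data_set \<Rightarrow> 'a \<Rightarrow> 'a \<Rightarrow> real" where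
  "feat_dist X x y =
     (if x \<in> pts X \<and> y \<in> pts X then (SUP f\<in>feats X. \<bar>f x - f y\<bar>) else 0)"

definition feat_topology :: "'a data_set \<Rightarrow> 'a topology" where
  "feat_topology X = Metric_space.mtopology (pts X) (feat_dist X)"

definition borel_of :: "'a topology \<Rightarrow> 'a measure" where
  "borel_of T = sigma (topspace T) {U. openin T U}"

definition geometric_data_set :: "'a data_set \<Rightarrow> bool" where
  "geometric_data_set X \<longleftrightarrow>
     feats X \<noteq> {} \<and> feats X \<subseteq> extensional (pts X) \<and>
     (\<forall>x\<in>pts X. \<forall>y\<in>pts X. bdd_above ((\<lambda>f. \<bar>f x - f y\<bar>) ` feats X)) \<and>
     Metric_space (pts X) (feat_dist X) \<and>
     Metric_space.mcomplete (pts X) (feat_dist X) \<and>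
     separable_space (feat_topology X) \<and>
     space (meas X) = pts X \<and> sets (meas X) = sets (borel_of (feat_topology X)) \<and>
     prob_space (meas X) \<and>
     (\<forall>U. openin (feat_topology X) U \<and> U \<noteq> {} \<longrightarrow> emeasure (meas X) U > 0)"

definition pointwise_closure :: "'a set \<Rightarrow> ('a \<Rightarrow> real) set \<Rightarrow> ('a \<Rightarrow> real) set" where
  "pointwise_closure S F = product_topology (\<lambda>_. euclideanreal) S closure_of F"

definition hausdorff_distance :: "('a \<Rightarrow> 'a \<Rightarrow> real) \<Rightarrow> 'a set \<Rightarrow> 'a set \<Rightarrow> real" where
  "hausdorff_distance d A B =
     max (SUP a\<in>A. INF b\<in>B. d a b) (SUP b\<in>B. INF a\<in>A. d a b)"

definition tau :: "real \<Rightarrow> real" where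
  "tau r = tanh r / 2"

definition K_tau :: "'a data_set \<Rightarrow> ('a \<Rightarrow> real) set" where
  "K_tau X = pointwise_closure (pts X) ((\<lambda>f. restrict (tau \<circ> f) (pts X)) ` feats X)"

definition couplings :: "'a data_set \<Rightarrow> 'b data_set \<Rightarrow> ('a \<times> 'b) measure set" where
  "couplings X Y =
     {\<pi>. space \<pi> = pts X \<times> pts Y \<and>
         sets \<pi> = sets (borel_of (prod_topology (feat_topology X) (feat_topology Y))) \<and>
         prob_space \<pi> \<and>
         distr \<pi> (meas X) fst = meas X \<and> distr \<pi> (meas Y) snd = meas Y}"

definition L1_dist :: "'a measure \<Rightarrow> ('a \<Rightarrow> real) \<Rightarrow> ('a \<Rightarrow> real) \<Rightarrow> real" where
  "L1_dist M u v = (\<integral>z. \<bar>u z - v z\<bar> \<partial>M)"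

definition D_tau :: "('a \<times> 'b) measure \<Rightarrow> 'a data_set \<Rightarrow> 'b data_set \<Rightarrow> real" where
  "D_tau \<pi> X Y =
     hausdorff_distance (L1_dist \<pi>) ((\<lambda>k. k \<circ> fst) ` K_tau X) ((\<lambda>k. k \<circ> snd) ` K_tau Y)"

definition d_tau :: "'a data_set \<Rightarrow> 'b data_set \<Rightarrow> real" where
  "d_tau X Y = (INF \<pi>\<in>couplings X Y. D_tau \<pi> X Y)"

definition ky_fan :: "'a measure \<Rightarrow> ('a \<Rightarrow> real) \<Rightarrow> ('a \<Rightarrow> real) \<Rightarrow> real" where
  "ky_fan M u v = Inf {\<epsilon>. 0 \<le> \<epsilon> \<and> measure M {z \<in> space M. \<bar>u z - v z\<bar> > \<epsilon>} \<le> \<epsilon>}"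

definition unit_lebesgue :: "real measure" where
  "unit_lebesgue = restrict_space lborel {0..<1}"

definition parameters :: "'a data_set \<Rightarrow> (real \<Rightarrow> 'a) set" where
  "parameters X =
     {\<phi>. \<phi> \<in> measurable unit_lebesgue (meas X) \<and> distr unit_lebesgue (meas X) \<phi> = meas X}"

definition d_conc :: "'a data_set \<Rightarrow> 'b data_set \<Rightarrow> real" where
  "d_conc X Y =
     (INF (\<phi>, \<psi>)\<in>parameters X \<times> parameters Y.
        hausdorff_distance (ky_fan unit_lebesgue)
          ((\<lambda>f. f \<circ> \<phi>) ` feats X) ((\<lambda>g. g \<circ> \<psi>) ` feats Y))"

end

theory Submission
  imports Defs
begin

text \<open>
  A pair of parameters induces a coupling. Since \<open>tau\<close> is 1/2-Lipschitz with values in an interval of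
  length 1, splitting at a level \<open>\<epsilon>\<close> admissible in the Ky Fan metric bounds the mean of
  \<open>\<bar>tau \<circ> u - tau \<circ> v\<bar>\<close> by \<open>\<epsilon> + (1 - \<epsilon>) \<epsilon> / 2\<close>. Passing to the pointwise closure costs nothing, because
  the features are equi-Lipschitz and the measure is concentrated on finitely many small balls.
  The infima range over nonempty sets because every Borel probability measure on a complete separable
  metric space has a parameter: code points by reals, take the quantile function of the image measure,
  and decode. No converse estimate holds since \<open>tau\<close> compresses the line near infinity: the one-point
  spaces with the constant features \<open>n\<close> and \<open>n + 1\<close> stay at observable distance 1.
\<close>

section \<open>Parameters of Borel probability measures\<close>

text \<open>With the digits 0 and 2 in base 4, every tail of an expansion stays below 1, so no carry
  can make two expansions agree.\<close>

lemma base4_series: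
  fixes b :: "nat \<Rightarrow> real"
  assumes "\<And>j. 0 \<le> b j" "\<And>j. b j \<le> 1"
  shows "summable (\<lambda>j. 2 * b j / 4 ^ Suc j)" (is ?S)
    and "0 \<le> (\<Sum>j. 2 * b j / 4 ^ Suc j)" (is ?N)
    and "(\<Sum>j. 2 * b j / 4 ^ Suc j) \<le> 2 / 3" (is ?L)
proof -
  have g: "(\<lambda>j. (1/2) * (1/4::real) ^ j) sums ((1/2) * (1 / (1 - 1/4)))"
    by (intro sums_mult geometric_sums) simp
  have le: "2 * b j / 4 ^ Suc j \<le> (1/2) * (1/4::real) ^ j" for j
    using assms(2)[of j] by (simp add: field_simps)
  show s: ?S
    by (rule summable_comparison_test'[OF sums_summable[OF g], of 0]) (use le assms in auto)
  show ?N
    using s assms by (intro suminf_nonneg) auto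
  have "(\<Sum>j. 2 * b j / 4 ^ Suc j) \<le> (\<Sum>j. (1/2) * (1/4::real) ^ j)"
    by (intro suminf_le le s sums_summable[OF g])
  also have "\<dots> = 2 / 3"
    using sums_unique[OF g] by simp
  finally show ?L .
qed

text \<open>Multiplication by \<open>4 ^ k\<close> moves the first \<open>k\<close> digits in front
  of the point and leaves the tail \<open>t k\<close>, where
  \<open>t k = b k / 2 + t (Suc k) / 4\<close>. The last summand is at most 1/6, so comparing the
  fractional part with 1/2 reads off the bit.\<close>

lemma base4_digit:
  fixes b :: "nat \<Rightarrow> real"
  assumes b: "\<And>j. b j = 0 \<or> b j = 1"
  shows "frac (4 ^ k * (\<Sum>j. 2 * b j / 4 ^ Suc j)) \<ge> 1/2 \<longleftrightarrow> b k = 1"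
proof -
  have b01: "0 \<le> b j" "b j \<le> 1" for j
    using b[of j] by auto
  define t where "t k = (\<Sum>j. 2 * b (j + k) / 4 ^ Suc j)" for k
  have tb: "0 \<le> t k" "t k \<le> 2/3" for k
    unfolding t_def by (rule base4_series(2,3); rule b01)+
  have step: "t k = 2 * b k / 4 + t (Suc k) / 4" for k
  proof -
    have "t k = 2 * b (0 + k) / 4 ^ Suc 0 + (\<Sum>j. 2 * b (Suc j + k) / 4 ^ Suc (Suc j))"
      unfolding t_def using base4_series(1)[of "\<lambda>j. b (j + k)"] b01
      by (subst suminf_split_head) auto
    also have "(\<Sum>j. 2 * b (Suc j + k) / 4 ^ Suc (Suc j)) = (\<Sum>j. (1/4) * (2 * b (j + Suc k) / 4 ^ Suc j))"
      by (intro suminf_cong) simp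
    also have "\<dots> = (1/4) * t (Suc k)"
      unfolding t_def by (intro suminf_mult base4_series b01)
    finally show ?thesis by simp
  qed
  have "\<exists>m::int. 4 ^ k * t 0 = of_int m + t k" for k
  proof (induction k)
    case (Suc k)
    then obtain m :: int where m: "4 ^ k * t 0 = of_int m + t k" by blast
    obtain d :: int where d: "b k = of_int d"
      using b[of k] by (metis of_int_0 of_int_1)
    have "4 ^ Suc k * t 0 = of_int (4 * m + 2 * d) + t (Suc k)"
      using m step[of k] d by simp
    then show ?case by blast
  qed (auto intro: exI[of _ 0])
  then obtain m :: int where m: "4 ^ k * t 0 = of_int m + t k" by blast
  have "frac (4 ^ k * t 0) = t k"
    using tb[of k] by (simp add: m frac_unique_iff)
  moreover have "t k \<ge> 1/2 \<longleftrightarrow> b k = 1"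
    using b[of k] step[of k] tb[of "Suc k"] by auto
  ultimately show ?thesis
    by (simp add: t_def)
qed

text \<open>The membership bits become the digits of a single real number, and testing a digit is a
  Borel condition on that number. In this way a whole sequence of measurable sets is pulled back
  from the line by one function.\<close>

lemma countably_many_sets_preimages:
  fixes A :: "nat \<Rightarrow> 'a set"
  assumes [measurable]: "\<And>k. A k \<in> sets M"
  shows "\<exists>(h :: 'a \<Rightarrow> real) B. h \<in> borel_measurable M \<and> (\<forall>k. B k \<in> sets borel) \<and>
    (\<forall>k x. h x \<in> B k \<longleftrightarrow> x \<in> A k)"
proof (intro exI conjI allI)
  let ?h = "\<lambda>x. \<Sum>j. 2 * indicator (A j) x / 4 ^ Suc j :: real"
  let ?B = "\<lambda>k. {r::real. frac (4 ^ k * r) \<ge> 1/2}"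
  show "?h \<in> borel_measurable M" by measurable
  show "?B k \<in> sets borel" for k
    unfolding frac_def by measurable
  show "?h x \<in> ?B k \<longleftrightarrow> x \<in> A k" for k x
    using base4_digit[of "\<lambda>j. indicator (A j) x" k] by (auto simp: indicator_def)
qed

section \<open>Borel sets of a topology\<close>

lemma sets_borel_of [simp]: "sets (borel_of T) = sigma_sets (topspace T) {U. openin T U}"
  unfolding borel_of_def by (rule sets_measure_of) (auto dest: openin_subset)

lemma space_borel_of [simp]: "space (borel_of T) = topspace T"
  unfolding borel_of_def by (rule space_measure_of) (auto dest: openin_subset)

lemma measurable_borel_ofI:
  assumes "f \<in> space M \<rightarrow> topspace T" "space N = topspace T" "sets N = sets (borel_of T)"
    and "\<And>U. openin T U \<Longrightarrow> {x \<in> space M. f x \<in> U} \<in> sets M"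
  shows "f \<in> measurable M N"
proof -
  have "f \<in> measurable M (borel_of T)"
    unfolding borel_of_def
    by (rule measurable_measure_of)
       (use assms in \<open>auto dest: openin_subset simp: vimage_def Int_def conj_commute\<close>)
  then show ?thesis
    by (subst measurable_cong_sets[OF refl assms(3)])
qed

lemma continuous_map_measurable:
  assumes f: "continuous_map S T f"
    and "space M = topspace S" "sets M = sets (borel_of S)"
    and "space N = topspace T" "sets N = sets (borel_of T)"
  shows "f \<in> measurable M N"
proof (rule measurable_borel_ofI)
  show "f \<in> space M \<rightarrow> topspace T"
    using continuous_map_image_subset_topspace[OF f] assms(2) by auto
  show "{x \<in> space M. f x \<in> U} \<in> sets M" if "openin T U" for U
    using openin_continuous_map_preimage[OF f that] assms(2,3) by auto
qed (use assms in auto)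

lemma continuous_map_borel_measurable:
  assumes "continuous_map S euclideanreal f"
    and "space M = topspace S" "sets M = sets (borel_of S)"
  shows "f \<in> borel_measurable M"
  using assms by (rule continuous_map_measurable) (auto simp: borel_def)

section \<open>Quantile functions on the unit interval\<close>

lemma space_unit_lebesgue [simp]: "space unit_lebesgue = {0..<1}"
  by (simp add: unit_lebesgue_def space_restrict_space)

lemma prob_space_unit_lebesgue: "prob_space unit_lebesgue"
  by (auto simp: unit_lebesgue_def space_restrict_space emeasure_restrict_space intro!: prob_spaceI)

text \<open>\<open>N.I\<close> is the generalized inverse of the distribution function and carries
  Lebesgue measure on the open unit interval to \<open>N\<close>. What remains is the passage to
  \<open>{0..<1}\<close>, which adds a null set.\<close>

lemma real_distribution_parameter:
  assumes "real_distribution N"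
  obtains J where "J \<in> borel_measurable unit_lebesgue" "distr unit_lebesgue borel J = N"
proof -
  interpret N: cdf_distribution N
    unfolding cdf_distribution_def by fact
  let ?O = "restrict_space lborel {0<..<1::real}"
  \<comment> \<open>The value 0 makes \<open>J\<close> Borel on the whole line; within
    \<open>{0..<1}\<close> it affects only the point 0.\<close>
  define J where "J t = (if t \<in> {0<..<1} then N.I t else 0)" for t :: real
  have J[measurable]: "J \<in> borel_measurable borel"
    unfolding J_def using N.measurable_CI
    by (subst (asm) measurable_restrict_space_iff[where c=0]) auto
  have Ju: "J \<in> borel_measurable unit_lebesgue"
    unfolding unit_lebesgue_def by (rule measurable_restrict_space1) simp
  have Jo: "J \<in> borel_measurable ?O"
    by (rule measurable_restrict_space1) simp
  have "distr unit_lebesgue borel J = distr ?O borel J"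
  proof (rule measure_eqI)
    fix A :: "real set" assume "A \<in> sets (distr unit_lebesgue borel J)"
    then have [measurable]: "A \<in> sets borel" by simp
    have [measurable]: "J -` A \<in> sets borel"
      using measurable_sets[OF J \<open>A \<in> sets borel\<close>] by simp
    have "emeasure (distr unit_lebesgue borel J) A = emeasure lborel (J -` A \<inter> {0..<1})"
      using Ju by (simp add: emeasure_distr)
        (auto simp: unit_lebesgue_def emeasure_restrict_space)
    also have "\<dots> = emeasure lborel (J -` A \<inter> {0<..<1})"
      using AE_lborel_singleton[of "0::real"] by (intro emeasure_eq_AE) auto
    also have "\<dots> = emeasure (distr ?O borel J) A"
      using Jo by (simp add: emeasure_distr space_restrict_space emeasure_restrict_space)
    finally show "emeasure (distr unit_lebesgue borel J) A = emeasure (distr ?O borel J) A" .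
  qed simp
  also have "\<dots> = distr ?O borel N.I"
    by (rule distr_cong) (auto simp: J_def space_restrict_space)
  also have "\<dots> = N" by (rule N.distr_I_eq_M)
  finally show thesis using that Ju by blast
qed

section \<open>Coding a complete separable metric space by real numbers\<close>

context Metric_space
begin

lemma separable_dense_sequence:
  assumes "separable_space mtopology" "M \<noteq> {}"
  shows "\<exists>a :: nat \<Rightarrow> 'a. range a \<subseteq> M \<and> (\<forall>x\<in>M. \<forall>e>0. \<exists>i. d (a i) x < e)"
proof -
  obtain C where C: "countable C" "C \<subseteq> M" "mtopology closure_of C = M"
    using assms unfolding separable_space_def by auto
  with \<open>M \<noteq> {}\<close> have "C \<noteq> {}" by auto
  have ran: "range (from_nat_into C) \<subseteq> M"
    using C from_nat_into[OF \<open>C \<noteq> {}\<close>] by blast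
  have "\<exists>i. d (from_nat_into C i) x < e" if x: "x \<in> M" and e: "0 < e" for x e
  proof -
    have "x \<in> mtopology closure_of C" using C x by simp
    then obtain y where "y \<in> C" "y \<in> mball x e"
      unfolding metric_closure_of using e by blast
    then show ?thesis
      by (metis C(1) commute from_nat_into_surj in_mball)
  qed
  with ran show ?thesis by blast
qed

text \<open>The limit lies in an open \<open>U\<close> exactly if, for some \<open>k\<close>, all
  but finitely many \<open>y n r\<close> lie in the set \<open>V k\<close> of points whose ball of
  radius \<open>1 / Suc k\<close> stays inside \<open>U\<close>. The hypothesis on \<open>y\<close>
  concerns arbitrary subsets of \<open>M\<close>, as suits approximants with countably many values,
  and so applies to \<open>V k\<close> directly.\<close>

lemma measurable_limit:
  assumes P: "space P = M" "sets P = sets (borel_of mtopology)"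
    and meas: "\<And>n U. U \<subseteq> M \<Longrightarrow> {r \<in> space N. y n r \<in> U} \<in> sets N"
    and lim: "\<And>r. r \<in> space N \<Longrightarrow> limitin mtopology (\<lambda>n. y n r) (g r) sequentially"
  shows "g \<in> measurable N P"
proof (rule measurable_borel_ofI)
  show "g \<in> space N \<rightarrow> topspace mtopology"
    using lim by (auto simp: limitin_metric)
  fix U assume U: "openin mtopology U"
  define V where "V k = {z \<in> M. mball z (1 / real (Suc k)) \<subseteq> U}" for k
  have "g r \<in> U \<longleftrightarrow> (\<exists>k N. \<forall>n\<ge>N. y n r \<in> V k)" if r: "r \<in> space N" for r
  proof
    assume "g r \<in> U"
    then obtain e where e: "e > 0" "mball (g r) e \<subseteq> U"
      using U unfolding openin_mtopology by blast
    \<comment> \<open>One half of \<open>e\<close> pays for the radius of the ball around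
      \<open>y n r\<close>, the other half for its distance to the limit.\<close>
    obtain k where k: "1 / real (Suc k) < e / 2"
      using e nat_approx_posE[of "e/2"] by auto
    have "\<forall>\<^sub>F n in sequentially. y n r \<in> M \<and> d (y n r) (g r) < e / 2"
      using lim[OF r] half_gt_zero[OF e(1)] unfolding limitin_metric by blast
    then obtain N where N: "\<And>n. n \<ge> N \<Longrightarrow> y n r \<in> M \<and> d (y n r) (g r) < e / 2"
      unfolding eventually_sequentially by blast
    have "y n r \<in> V k" if "n \<ge> N" for n
    proof -
      have gM: "g r \<in> M" using lim[OF r] by (simp add: limitin_metric)
      have "z \<in> mball (g r) e" if "z \<in> mball (y n r) (1 / real (Suc k))" for z
        using that N[OF \<open>n \<ge> N\<close>] k gM triangle[of "g r" "y n r" z] commute[of "g r" "y n r"]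
        by auto
      with N[OF that] e show ?thesis unfolding V_def by blast
    qed
    then show "\<exists>k N. \<forall>n\<ge>N. y n r \<in> V k" by blast
  next
    assume "\<exists>k N. \<forall>n\<ge>N. y n r \<in> V k"
    then obtain k N where N: "\<And>n. n \<ge> N \<Longrightarrow> y n r \<in> V k" by blast
    have "\<forall>\<^sub>F n in sequentially. y n r \<in> M \<and> d (y n r) (g r) < 1 / real (Suc k)"
      using lim[OF r] unfolding limitin_metric by (auto simp del: of_nat_Suc)
    then obtain n where n: "n \<ge> N" "y n r \<in> M" "d (y n r) (g r) < 1 / real (Suc k)"
      unfolding eventually_sequentially by (meson nle_le)
    then have "g r \<in> mball (y n r) (1 / real (Suc k))"
      using lim[OF r] by (simp add: limitin_metric)
    then show "g r \<in> U" using N[OF n(1)] unfolding V_def by blast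
  qed
  then have "{r \<in> space N. g r \<in> U} = {r \<in> space N. \<exists>k N. \<forall>n\<ge>N. y n r \<in> V k}"
    by auto
  also have "\<dots> \<in> sets N"
  proof -
    have [measurable]: "{r \<in> space N. y n r \<in> V k} \<in> sets N" for n k
      by (rule meas) (auto simp: V_def)
    show ?thesis by measurable
  qed
  finally show "{r \<in> space N. g r \<in> U} \<in> sets N" .
qed (use P in auto)

text \<open>\<open>h\<close> records which small balls around a dense sequence contain a point. From
  this code one reads, for each \<open>n\<close>, the least index of a ball of radius
  \<open>1 / Suc n\<close> containing the point. These centres converge to the point, and
  \<open>g\<close> is their limit, extended to a Borel map on all reals.\<close>

lemma polish_real_encoding:
  assumes comp: "mcomplete" and sep: "separable_space mtopology"
    and P: "space P = M" "sets P = sets (borel_of mtopology)" and "M \<noteq> {}"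
  obtains h :: "'a \<Rightarrow> real" and g :: "real \<Rightarrow> 'a"
  where "h \<in> borel_measurable P" "g \<in> measurable borel P" "\<And>x. x \<in> M \<Longrightarrow> g (h x) = x"
proof -
  obtain a :: "nat \<Rightarrow> 'a" where aM: "range a \<subseteq> M" and a: "\<And>x e. x \<in> M \<Longrightarrow> 0 < e \<Longrightarrow> \<exists>i. d (a i) x < e"
    using separable_dense_sequence[OF sep \<open>M \<noteq> {}\<close>] by blast
  have a_in[simp]: "a i \<in> M" for i using aM by auto
  define A where "A n i = mball (a i) (1 / real (Suc n))" for n i :: nat
  have "A n i \<in> sets P" for n i
    unfolding P(2) A_def by auto
  define A' where "A' k = (\<lambda>(n, i). A n i) (prod_decode k)" for k
  have "A' k \<in> sets P" for k
    using \<open>\<And>n i. A n i \<in> sets P\<close> by (simp add: A'_def split: prod.split)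
  then obtain h :: "'a \<Rightarrow> real" and B :: "nat \<Rightarrow> real set"
    where h: "h \<in> borel_measurable P" and B: "\<forall>k. B k \<in> sets borel"
      and "\<forall>k x. h x \<in> B k \<longleftrightarrow> x \<in> A' k"
    using countably_many_sets_preimages[of A' P] by blast
  then have hB: "h x \<in> B (prod_encode (n, i)) \<longleftrightarrow> x \<in> A n i" for n i x
    by (simp add: A'_def)
  \<comment> \<open>If \<open>r\<close> lies in none of these sets, \<open>LEAST\<close> yields an
    unspecified index. This is harmless: only codes \<open>h x\<close> have to be decoded, and for
    them an index exists by density.\<close>
  define S where "S n r = (LEAST i. r \<in> B (prod_encode (n, i)))" for n r
  have [measurable]: "B k \<in> sets borel" for k by (rule B[rule_format])
  have S[measurable]: "S n \<in> measurable borel (count_space UNIV)" for n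
    unfolding S_def by measurable
  have S_h: "d (a (S n (h x))) x < 1 / real (Suc n)" if "x \<in> M" for n x
  proof -
    have "\<exists>i. h x \<in> B (prod_encode (n, i))"
      using a[OF that, of "1 / real (Suc n)"] that by (auto simp: hB A_def simp del: of_nat_Suc)
    then have "h x \<in> B (prod_encode (n, S n (h x)))"
      unfolding S_def by (rule LeastI_ex)
    then show ?thesis by (auto simp: hB A_def)
  qed
  define y where "y n r = a (S n r)" for n r
  define G where "G = {r. MCauchy (\<lambda>n. y n r)}"
  \<comment> \<open>Countably many tolerances test the Cauchy property, which makes \<open>G\<close>
    a Borel set.\<close>
  have "G = {r. \<forall>k. \<exists>N. \<forall>n\<ge>N. \<forall>n'\<ge>N. d (a (S n r)) (a (S n' r)) < 1 / real (Suc k)}"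
  proof -
    have "MCauchy (\<lambda>n. y n r) \<longleftrightarrow>
      (\<forall>k. \<exists>N. \<forall>n\<ge>N. \<forall>n'\<ge>N. d (y n r) (y n' r) < 1 / real (Suc k))" (is "_ \<longleftrightarrow> ?R") for r
    proof
      assume "MCauchy (\<lambda>n. y n r)"
      then show ?R unfolding MCauchy_def by (metis of_nat_0_less_iff zero_less_Suc zero_less_divide_1_iff)
    next
      assume R: ?R
      have "\<exists>N. \<forall>n n'. N \<le> n \<longrightarrow> N \<le> n' \<longrightarrow> d (y n r) (y n' r) < e" if "e > 0" for e
        using R nat_approx_posE[OF that] by (meson order_less_trans)
      then show "MCauchy (\<lambda>n. y n r)" unfolding MCauchy_def by (auto simp: y_def)
    qed
    then show ?thesis by (simp add: G_def y_def)
  qed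
  also have "\<dots> \<in> sets borel"
  proof -
    have [measurable]: "(\<lambda>r. d (a (S n r)) (a (S n' r))) \<in> borel_measurable borel" for n n'
      by (rule measurable_compose_countable[of "\<lambda>i r. d (a i) (a (S n' r))", OF _ S]) measurable
    show ?thesis by measurable
  qed
  finally have G[measurable]: "G \<in> sets borel" .
  \<comment> \<open>Off \<open>G\<close> the sequence is replaced by a constant one, so a limit
    exists for every real \<open>r\<close>.\<close>
  define y' where "y' n r = (if r \<in> G then y n r else a 0)" for n r
  have "\<exists>l. limitin mtopology (\<lambda>n. y' n r) l sequentially" for r
    using comp by (cases "r \<in> G") (auto simp: y'_def G_def mcomplete_def limitin_const_iff intro: a_in)
  then obtain g where g: "\<And>r. limitin mtopology (\<lambda>n. y' n r) (g r) sequentially"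
    by metis
  have "g \<in> measurable borel P"
  proof (rule measurable_limit[OF P])
    fix n U
    have [measurable]: "{r \<in> space borel. a (S n r) \<in> U} \<in> sets borel"
      using measurable_sets[OF S[of n], of "a -` U"] by (simp add: vimage_def)
    show "{r \<in> space borel. y' n r \<in> U} \<in> sets borel"
      unfolding y'_def y_def by (cases "a 0 \<in> U") (simp_all cong: conj_cong; measurable)+
  qed (use g in auto)
  moreover have "g (h x) = x" if x: "x \<in> M" for x
  proof -
    have "limitin mtopology (\<lambda>n. y n (h x)) x sequentially"
      unfolding limitin_metric
    proof (intro conjI allI impI x)
      fix e :: real assume "e > 0"
      then obtain k where k: "1 / real (Suc k) < e" using nat_approx_posE by blast
      have "d (y n (h x)) x < e" if "n \<ge> k" for n
      proof -
        have "1 / real (Suc n) \<le> 1 / real (Suc k)" using that by (intro divide_left_mono) auto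
        then show ?thesis using S_h[OF x, of n] k by (simp add: y_def)
      qed
      then show "\<forall>\<^sub>F n in sequentially. y n (h x) \<in> M \<and> d (y n (h x)) x < e"
        unfolding eventually_sequentially by (auto simp: y_def)
    qed
    moreover from this have "h x \<in> G"
      unfolding G_def using aM by (auto simp: y_def intro!: convergent_imp_MCauchy)
    ultimately show ?thesis
      using g[of "h x"] limitin_metric_unique[OF _ _ sequentially_bot] by (simp add: y'_def)
  qed
  ultimately show thesis using that h by blast
qed

lemma polish_parameter:
  assumes "mcomplete" "separable_space mtopology"
    and P: "space P = M" "sets P = sets (borel_of mtopology)" and "prob_space P"
  shows "\<exists>\<phi>\<in>measurable unit_lebesgue P. distr unit_lebesgue P \<phi> = P"
proof -
  interpret P: prob_space P by fact
  have "M \<noteq> {}" using P.not_empty P by simp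
  then obtain h :: "'a \<Rightarrow> real" and g where h[measurable]: "h \<in> borel_measurable P"
    and g[measurable]: "g \<in> measurable borel P" and gh: "\<And>x. x \<in> M \<Longrightarrow> g (h x) = x"
    using polish_real_encoding[OF assms(1,2) P] by blast
  have "real_distribution (distr P borel h)"
    by (rule P.real_distribution_distr) simp
  then obtain J where J[measurable]: "J \<in> borel_measurable unit_lebesgue"
    and dJ: "distr unit_lebesgue borel J = distr P borel h"
    by (rule real_distribution_parameter)
  have "distr unit_lebesgue P (g \<circ> J) = distr (distr unit_lebesgue borel J) P g"
    by (rule distr_distr[symmetric]) measurable
  also have "\<dots> = distr P P (g \<circ> h)"
    unfolding dJ by (rule distr_distr) measurable
  also have "\<dots> = P"
    using distr_cong[of P P P P "g \<circ> h" "\<lambda>x. x"] by (simp add: gh P)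
  finally show ?thesis by (auto intro!: bexI[of _ "g \<circ> J"])
qed

end

section \<open>Countable bases and pairs of measurable maps\<close>

lemma (in Metric_space) separable_imp_second_countable:
  assumes "separable_space mtopology"
  shows "second_countable mtopology"
proof (cases "M = {}")
  case False
  then obtain a :: "nat \<Rightarrow> 'a" where aM: "range a \<subseteq> M"
    and a: "\<And>x e. x \<in> M \<Longrightarrow> 0 < e \<Longrightarrow> \<exists>i. d (a i) x < e"
    using separable_dense_sequence[OF assms] by blast
  let ?B = "range (\<lambda>(i, k). mball (a i) (1 / real (Suc k)))"
  have "\<exists>V\<in>?B. x \<in> V \<and> V \<subseteq> U" if U: "openin mtopology U" "x \<in> U" for U x
  proof -
    have x: "x \<in> M" using U openin_subset by fastforce
    obtain e where e: "e > 0" "mball x e \<subseteq> U"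
      using U unfolding openin_mtopology by blast
    \<comment> \<open>With a radius below \<open>e / 2\<close>, a ball around some
      \<open>a i\<close> that contains \<open>x\<close> lies in the ball of radius \<open>e\<close>
      around \<open>x\<close>.\<close>
    obtain k where k: "1 / real (Suc k) < e / 2"
      using e nat_approx_posE[of "e/2"] by auto
    obtain i where i: "d (a i) x < 1 / real (Suc k)"
      using a[OF x, of "1 / real (Suc k)"] by (auto simp del: of_nat_Suc)
    have "z \<in> mball x e" if "z \<in> mball (a i) (1 / real (Suc k))" for z
      using that i k x triangle[of x "a i" z] commute[of x "a i"] by auto
    then have "x \<in> mball (a i) (1 / real (Suc k))" "mball (a i) (1 / real (Suc k)) \<subseteq> U"
      using i x aM e by auto
    then show ?thesis by (auto intro!: bexI[of _ "mball (a i) (1 / real (Suc k))"])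
  qed
  then show ?thesis
    unfolding second_countable_def by (intro exI[of _ ?B]) (auto split: prod.splits)
next
  case True
  have "U \<subseteq> M" if "openin mtopology U" for U
    using that by (simp add: openin_mtopology)
  with True have "x \<notin> U" if "openin mtopology U" for U x
    using that by blast
  then show ?thesis unfolding second_countable_def by (intro exI[of _ "{}"]) auto
qed

text \<open>Couplings live on the Borel sets of the product topology. Countable bases turn an open
  set of the product into a countable union of basic rectangles, indexed by \<open>I\<close>, and
  the preimage of a rectangle is an intersection of two measurable sets.\<close>

lemma measurable_Pair_prod_topology:
  assumes "second_countable S" "second_countable T"
    and f: "f \<in> measurable N P" and P: "space P = topspace S" "sets P = sets (borel_of S)"
    and g: "g \<in> measurable N Q" and Q: "space Q = topspace T" "sets Q = sets (borel_of T)"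
  shows "(\<lambda>t. (f t, g t)) \<in> measurable N (borel_of (prod_topology S T))"
proof (rule measurable_borel_ofI)
  show "(\<lambda>t. (f t, g t)) \<in> space N \<rightarrow> topspace (prod_topology S T)"
    using measurable_space[OF f] measurable_space[OF g] P Q by auto
  fix U assume U: "openin (prod_topology S T) U"
  obtain B where B: "countable B" "\<forall>V\<in>B. openin S V"
    and B': "\<forall>U x. openin S U \<and> x \<in> U \<longrightarrow> (\<exists>V\<in>B. x \<in> V \<and> V \<subseteq> U)"
    using assms(1) unfolding second_countable_def by blast
  obtain C where C: "countable C" "\<forall>V\<in>C. openin T V"
    and C': "\<forall>U x. openin T U \<and> x \<in> U \<longrightarrow> (\<exists>V\<in>C. x \<in> V \<and> V \<subseteq> U)"
    using assms(2) unfolding second_countable_def by blast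
  define I where "I = {p \<in> B \<times> C. \<forall>x\<in>fst p. \<forall>y\<in>snd p. (x, y) \<in> U}"
  have "\<exists>p\<in>I. x \<in> fst p \<and> y \<in> snd p" if "(x, y) \<in> U" for x y
  proof -
    have "\<exists>V W. openin S V \<and> openin T W \<and> x \<in> V \<and> y \<in> W \<and> V \<times> W \<subseteq> U"
      using U that unfolding openin_prod_topology_alt by simp
    then obtain V W where VW: "openin S V" "openin T W" "x \<in> V" "y \<in> W" "V \<times> W \<subseteq> U"
      by (elim exE conjE) (rule that)
    obtain V' where V': "V' \<in> B" "x \<in> V'" "V' \<subseteq> V" using B' VW(1,3) by blast
    obtain W' where W': "W' \<in> C" "y \<in> W'" "W' \<subseteq> W" using C' VW(2,4) by blast
    show ?thesis
      using V' W' VW(5) by (intro bexI[of _ "(V', W')"]) (auto simp: I_def)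
  qed
  then have "{t \<in> space N. (f t, g t) \<in> U} =
      (\<Union>p\<in>I. (f -` fst p \<inter> space N) \<inter> (g -` snd p \<inter> space N))"
    by (auto simp: I_def)
  also have "\<dots> \<in> sets N"
  proof -
    have "countable I"
      unfolding I_def by (rule countable_subset[of _ "B \<times> C"]) (auto simp: B C)
    moreover have "(f -` fst p \<inter> space N) \<inter> (g -` snd p \<inter> space N) \<in> sets N" if "p \<in> I" for p
      using that B(2) C(2) unfolding I_def
      by (intro sets.Int measurable_sets[OF f] measurable_sets[OF g]) (auto simp: P Q)
    ultimately show ?thesis by (intro sets.countable_UN'') auto
  qed
  finally show "{t \<in> space N. (f t, g t) \<in> U} \<in> sets N" .
qed auto

lemma (in Metric_space) nonexpansive_imp_continuous_map:
  assumes "\<And>x y. x \<in> M \<Longrightarrow> y \<in> M \<Longrightarrow> \<bar>u x - u y\<bar> \<le> d x y"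
  shows "continuous_map mtopology euclideanreal u"
  unfolding continuous_map_def
proof (intro conjI allI impI)
  fix U :: "real set" assume "openin euclideanreal U"
  then have "open U" by simp
  have "\<exists>e>0. mball x e \<subseteq> {x \<in> M. u x \<in> U}" if x: "x \<in> M" "u x \<in> U" for x
  proof -
    obtain e where e: "e > 0" "\<And>r. dist r (u x) < e \<Longrightarrow> r \<in> U"
      using \<open>open U\<close> x unfolding open_dist by blast
    have "mball x e \<subseteq> {x \<in> M. u x \<in> U}"
      using assms[of x] e(2) by (force simp: dist_real_def)
    with e show ?thesis by blast
  qed
  then show "openin mtopology {x \<in> topspace mtopology. u x \<in> U}"
    by (auto simp: openin_mtopology)
qed auto

section \<open>Features and their compactification\<close>

text \<open>Closeness on finitely many points is a basic neighbourhood for pointwise convergence: a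
  ball in each coordinate of \<open>I\<close>, the whole line in the others.\<close>

lemma pointwise_closure_approx:
  assumes u: "u \<in> pointwise_closure S F" and I: "finite I" "I \<subseteq> S" and "0 < e"
  shows "\<exists>f\<in>F. \<forall>x\<in>I. \<bar>u x - f x\<bar> < e"
proof -
  let ?T = "product_topology (\<lambda>_. euclideanreal) S"
  let ?W = "\<lambda>x. if x \<in> I then ball (u x) e else UNIV"
  have "openin ?T (PiE S ?W)"
    using I by (subst openin_PiE_gen) (auto intro: finite_subset[of _ I])
  moreover have "u \<in> PiE S ?W"
    using u \<open>0 < e\<close> unfolding pointwise_closure_def in_closure_of by (auto simp: PiE_def)
  ultimately obtain f where "f \<in> F" "f \<in> PiE S ?W"
    using u unfolding pointwise_closure_def in_closure_of by blast
  then have "\<bar>u x - f x\<bar> < e" if "x \<in> I" for x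
    using PiE_mem[of f S ?W x] that I by (auto simp: dist_real_def)
  with \<open>f \<in> F\<close> show ?thesis by blast
qed

lemma abs_tau_le: "\<bar>tau r\<bar> \<le> 1 / 2"
  using tanh_real_lt_1[of r] tanh_real_gt_neg1[of r] by (auto simp: tau_def)

text \<open>The derivative of \<open>tanh\<close> is at most 1, so \<open>t - tanh t\<close> is
  nondecreasing; the factor 1/2 in \<open>tau\<close> halves the Lipschitz constant.\<close>

lemma tau_lipschitz: "\<bar>tau a - tau b\<bar> \<le> \<bar>a - b\<bar> / 2"
proof -
  have *: "tanh y - tanh x \<le> y - x" if "x \<le> y" for x y :: real
  proof -
    have "(\<lambda>t. t - tanh t) x \<le> (\<lambda>t. t - tanh t) y"
      by (rule DERIV_nonneg_imp_nondecreasing[OF that])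
         (auto intro!: exI derivative_eq_intros)
    then show ?thesis by simp
  qed
  have **: "tanh x \<le> tanh y" if "x \<le> y" for x y :: real
    using that by simp
  show ?thesis
    using *[of a b] *[of b a] **[of a b] **[of b a] unfolding tau_def
    by (cases "a \<le> b") (auto simp: abs_if field_simps)
qed

lemma measurable_tau [measurable]: "tau \<in> borel_measurable borel"
  by (intro borel_measurable_continuous_onI)
     (auto simp: tau_def[abs_def] intro!: continuous_intros)

section \<open>Regularity of the features and of their pointwise closure\<close>

context
  fixes X :: "'a data_set"
  assumes X: "geometric_data_set X"
begin

interpretation Metric_space "pts X" "feat_dist X"
  using X by (simp add: geometric_data_set_def)

interpretation prob_space "meas X"
  using X by (simp add: geometric_data_set_def)

lemma topspace_feat_topology: "topspace (feat_topology X) = pts X"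
  by (simp add: feat_topology_def)

lemma space_meas: "space (meas X) = pts X"
  and sets_meas: "sets (meas X) = sets (borel_of (feat_topology X))"
  using X unfolding geometric_data_set_def by auto

lemma second_countable_feat_topology: "second_countable (feat_topology X)"
  using X unfolding feat_topology_def geometric_data_set_def
  by (intro separable_imp_second_countable) simp

lemma parameters_nonempty: "parameters X \<noteq> {}"
proof -
  have "\<exists>\<phi>\<in>measurable unit_lebesgue (meas X). distr unit_lebesgue (meas X) \<phi> = meas X"
    by (rule polish_parameter) (use X in \<open>auto simp: geometric_data_set_def feat_topology_def\<close>)
  then show ?thesis by (auto simp: parameters_def)
qed

lemma feat_nonexpansive:
  assumes "f \<in> feats X" "x \<in> pts X" "y \<in> pts X"
  shows "\<bar>f x - f y\<bar> \<le> feat_dist X x y"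
proof -
  have "bdd_above ((\<lambda>f. \<bar>f x - f y\<bar>) ` feats X)"
    using assms X by (simp add: geometric_data_set_def)
  from cSUP_upper[OF assms(1) this] show ?thesis
    using assms by (simp add: feat_dist_def)
qed

lemma tau_feat_nonexpansive:
  assumes "f \<in> feats X" "x \<in> pts X" "y \<in> pts X"
  shows "\<bar>tau (f x) - tau (f y)\<bar> \<le> feat_dist X x y"
proof -
  have "\<bar>tau (f x) - tau (f y)\<bar> \<le> \<bar>f x - f y\<bar>"
    by (rule order_trans[OF tau_lipschitz]) simp
  with feat_nonexpansive[OF assms] show ?thesis by (rule order_trans[rotated])
qed

lemma tau_feat_in_K_tau:
  assumes "f \<in> feats X"
  shows "restrict (tau \<circ> f) (pts X) \<in> K_tau X"
proof -
  have "(\<lambda>f. restrict (tau \<circ> f) (pts X)) ` feats X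
      \<subseteq> K_tau X"
    unfolding K_tau_def pointwise_closure_def by (rule closure_of_subset) auto
  with assms show ?thesis by blast
qed

lemma K_tau_nonempty: "K_tau X \<noteq> {}"
proof -
  obtain f where "f \<in> feats X" using X by (auto simp: geometric_data_set_def)
  from tau_feat_in_K_tau[OF this] show ?thesis by auto
qed

lemma K_tau_approx:
  assumes "u \<in> K_tau X" "finite I" "I \<subseteq> pts X" "0 < e"
  shows "\<exists>f\<in>feats X. \<forall>x\<in>I. \<bar>u x - tau (f x)\<bar> < e"
proof -
  obtain g where "g \<in> (\<lambda>f. restrict (tau \<circ> f) (pts X)) ` feats X" "\<forall>x\<in>I. \<bar>u x - g x\<bar> < e"
    using pointwise_closure_approx[OF assms(1)[unfolded K_tau_def] assms(2-4)] by blast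
  with assms(3) show ?thesis by (force simp: subset_iff)
qed

lemma K_tau_abs_le:
  assumes "u \<in> K_tau X" "x \<in> pts X"
  shows "\<bar>u x\<bar> \<le> 1 / 2"
proof (rule field_le_epsilon)
  fix e :: real assume "e > 0"
  then obtain f where "\<bar>u x - tau (f x)\<bar> < e"
    using K_tau_approx[OF assms(1), of "{x}"] assms by auto
  then show "\<bar>u x\<bar> \<le> 1 / 2 + e" using abs_tau_le[of "f x"] by linarith
qed

text \<open>A condition on two points survives pointwise closure, so the closure keeps the common
  modulus of the features. This makes its elements continuous and Borel, which pointwise limits of
  nets of Borel functions need not be.\<close>

lemma K_tau_nonexpansive:
  assumes "u \<in> K_tau X" "x \<in> pts X" "y \<in> pts X"
  shows "\<bar>u x - u y\<bar> \<le> feat_dist X x y"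
proof (rule field_le_epsilon)
  fix e :: real assume "e > 0"
  then obtain f where f: "f \<in> feats X" "\<bar>u x - tau (f x)\<bar> < e / 2" "\<bar>u y - tau (f y)\<bar> < e / 2"
    using K_tau_approx[OF assms(1), of "{x, y}" "e / 2"] assms by auto
  then show "\<bar>u x - u y\<bar> \<le> feat_dist X x y + e"
    using tau_feat_nonexpansive[OF f(1) assms(2,3)] by linarith
qed

lemma continuous_map_K_tau: "u \<in> K_tau X \<Longrightarrow> continuous_map (feat_topology X) euclideanreal u"
  unfolding feat_topology_def
  by (rule nonexpansive_imp_continuous_map) (rule K_tau_nonexpansive)

lemma continuous_map_feat: "f \<in> feats X \<Longrightarrow> continuous_map (feat_topology X) euclideanreal f"
  unfolding feat_topology_def
  by (rule nonexpansive_imp_continuous_map) (rule feat_nonexpansive)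

lemma measurable_K_tau: "u \<in> K_tau X \<Longrightarrow> u \<in> borel_measurable (meas X)"
  by (rule continuous_map_borel_measurable[OF continuous_map_K_tau])
     (auto simp: space_meas sets_meas topspace_feat_topology)

lemma measurable_feat: "f \<in> feats X \<Longrightarrow> f \<in> borel_measurable (meas X)"
  by (rule continuous_map_borel_measurable[OF continuous_map_feat])
     (auto simp: space_meas sets_meas topspace_feat_topology)

text \<open>The features are equicontinuous, so closeness on finitely many points whose small balls
  carry almost all the mass gives closeness in mean.\<close>

lemma K_tau_L1_approx:
  assumes u: "u \<in> K_tau X" and "0 < e"
  shows "\<exists>f\<in>feats X. (\<integral>x. \<bar>u x - tau (f x)\<bar> \<partial>meas X) \<le> e"
proof -
  \<comment> \<open>There are four errors of size \<open>\<eta>\<close>: two from moving between a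
    point and the centre of its ball, one at the centre, and one for the mass outside
    \<open>U n\<close>.\<close>
  define \<eta> where "\<eta> = e / 4"
  have \<eta>: "\<eta> > 0" using \<open>0 < e\<close> by (simp add: \<eta>_def)
  have "pts X \<noteq> {}" using not_empty space_meas by simp
  moreover have "separable_space mtopology"
    using X unfolding geometric_data_set_def feat_topology_def by blast
  ultimately obtain a :: "nat \<Rightarrow> 'a" where aM: "range a \<subseteq> pts X"
    and a: "\<And>x e. x \<in> pts X \<Longrightarrow> 0 < e \<Longrightarrow> \<exists>i. feat_dist X (a i) x < e"
    using separable_dense_sequence by blast
  \<comment> \<open>By density these finite unions exhaust the space, so by continuity of the
    measure some \<open>U n\<close> misses less than \<open>\<eta>\<close> of the mass.\<close>
  define U where "U n = (\<Union>i<n. mball (a i) \<eta>)" for n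
  have Us[measurable]: "U n \<in> sets (meas X)" for n
    unfolding U_def sets_meas feat_topology_def
    by (auto intro!: sets.finite_UN sigma_sets.Basic)
  have "(\<lambda>n. prob (U n)) \<longlonglongrightarrow> prob (\<Union>n. U n)"
    by (rule finite_Lim_measure_incseq) (auto simp: incseq_def U_def, use Us in \<open>auto simp: U_def\<close>)
  moreover have "(\<Union>n. U n) = space (meas X)"
    using a[OF _ \<eta>] aM by (fastforce simp: U_def space_meas)
  ultimately have "(\<lambda>n. prob (U n)) \<longlonglongrightarrow> 1" by (simp add: prob_space)
  then have "\<forall>\<^sub>F n in sequentially. prob (U n) > 1 - \<eta>"
    by (rule order_tendstoD) (use \<eta> in simp)
  then obtain n where n: "prob (U n) > 1 - \<eta>"
    unfolding eventually_sequentially by blast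
  have "a ` {..<n} \<subseteq> pts X" using aM by auto
  then obtain f where f: "f \<in> feats X" "\<And>i. i < n \<Longrightarrow> \<bar>u (a i) - tau (f (a i))\<bar> < \<eta>"
    using K_tau_approx[OF u, of "a ` {..<n}" \<eta>] \<eta> by auto
  have [measurable]: "u \<in> borel_measurable (meas X)" "f \<in> borel_measurable (meas X)"
    using measurable_K_tau[OF u] measurable_feat[OF f(1)] by auto
  have le1: "\<bar>u x - tau (f x)\<bar> \<le> 1" if "x \<in> pts X" for x
    using K_tau_abs_le[OF u that] abs_tau_le[of "f x"] by linarith
  have le: "\<bar>u x - tau (f x)\<bar> \<le> 3 * \<eta> + indicator (space (meas X) - U n) x" if x: "x \<in> pts X" for x
  proof (cases "x \<in> U n")
    case True
    then obtain i where i: "i < n" "x \<in> mball (a i) \<eta>" by (auto simp: U_def)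
    then show ?thesis
      using f(2)[OF i(1)] K_tau_nonexpansive[OF u, of "a i" x] 
        tau_feat_nonexpansive[OF f(1), of "a i" x] True by auto
  next
    case False
    then show ?thesis using le1[OF x] \<eta> x by (simp add: space_meas)
  qed
  have int: "integrable (meas X) (indicat_real (space (meas X) - U n))"
    by (rule integrable_const_bound[of _ 1]) (auto simp: indicator_def)
  have "(\<integral>x. \<bar>u x - tau (f x)\<bar> \<partial>meas X)
      \<le> (\<integral>x. 3 * \<eta> + indicator (space (meas X) - U n) x \<partial>meas X)"
  proof (rule integral_mono)
    show "integrable (meas X) (\<lambda>x. \<bar>u x - tau (f x)\<bar>)"
      by (rule integrable_const_bound[of _ 1]) (use le1 in \<open>auto simp: space_meas\<close>)
    show "integrable (meas X) (\<lambda>x. 3 * \<eta> + indicator (space (meas X) - U n) x)"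
      using int by simp
  qed (use le in \<open>auto simp: space_meas\<close>)
  also have "\<dots> = 3 * \<eta> + prob (space (meas X) - U n)"
    using int by (subst Bochner_Integration.integral_add) (simp_all add: prob_space)
  also have "\<dots> = 3 * \<eta> + (1 - prob (U n))"
    by (simp add: prob_compl)
  also have "\<dots> \<le> e" using n by (simp add: \<eta>_def)
  finally show ?thesis using f(1) by blast
qed

end

section \<open>Comparison of the two distances\<close>

text \<open>Real suprema and infima have their usual meaning only on bounded nonempty families; the
  common bound \<open>c\<close> on \<open>d\<close> provides this for both one-sided terms.\<close>

lemma hausdorff_distance_bounds:
  assumes "A \<noteq> {}" "B \<noteq> {}" and d: "\<And>a b. a \<in> A \<Longrightarrow> b \<in> B \<Longrightarrow> 0 \<le> d a b \<and> d a b \<le> c"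
  shows "0 \<le> hausdorff_distance d A B" "hausdorff_distance d A B \<le> c"
    and "\<And>a. a \<in> A \<Longrightarrow> (INF b\<in>B. d a b) \<le> hausdorff_distance d A B"
    and "\<And>b. b \<in> B \<Longrightarrow> (INF a\<in>A. d a b) \<le> hausdorff_distance d A B"
proof -
  obtain a0 b0 where a0: "a0 \<in> A" and b0: "b0 \<in> B" using assms by blast
  have bddA: "bdd_below ((\<lambda>a. d a b) ` A)" if "b \<in> B" for b
    using d that by (auto intro!: bdd_belowI[of _ 0])
  have bddB: "bdd_below ((\<lambda>b. d a b) ` B)" if "a \<in> A" for a
    using d that by (auto intro!: bdd_belowI[of _ 0])
  have A: "0 \<le> (INF b\<in>B. d a b)" "(INF b\<in>B. d a b) \<le> c" if "a \<in> A" for a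
    using d that \<open>B \<noteq> {}\<close> b0 bddB[OF that] by (auto intro!: cINF_greatest intro: cINF_lower2)
  have B: "0 \<le> (INF a\<in>A. d a b)" "(INF a\<in>A. d a b) \<le> c" if "b \<in> B" for b
    using d that \<open>A \<noteq> {}\<close> a0 bddA[OF that] by (auto intro!: cINF_greatest intro: cINF_lower2)
  have upA: "(INF b\<in>B. d a b) \<le> (SUP a\<in>A. INF b\<in>B. d a b)" if "a \<in> A" for a
    using that A(2) by (intro cSUP_upper bdd_aboveI2) auto
  have upB: "(INF a\<in>A. d a b) \<le> (SUP b\<in>B. INF a\<in>A. d a b)" if "b \<in> B" for b
    using that B(2) by (intro cSUP_upper bdd_aboveI2) auto
  show "(INF b\<in>B. d a b) \<le> hausdorff_distance d A B" if "a \<in> A" for a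
    using upA[OF that] by (simp add: hausdorff_distance_def)
  show "(INF a\<in>A. d a b) \<le> hausdorff_distance d A B" if "b \<in> B" for b
    using upB[OF that] by (simp add: hausdorff_distance_def)
  show "0 \<le> hausdorff_distance d A B"
    using upA[OF a0] A(1)[OF a0] by (simp add: hausdorff_distance_def)
  show "hausdorff_distance d A B \<le> c"
    using assms A(2) B(2) by (auto simp: hausdorff_distance_def intro!: cSUP_least)
qed

text \<open>A nearest partner need not exist; the slack \<open>e\<close> admits nearly optimal
  ones.\<close>

lemma hausdorff_distance_le:
  assumes "A \<noteq> {}" "B \<noteq> {}" and d: "\<And>a b. a \<in> A \<Longrightarrow> b \<in> B \<Longrightarrow> 0 \<le> d a b"
    and A: "\<And>a e. a \<in> A \<Longrightarrow> 0 < e \<Longrightarrow> \<exists>b\<in>B. d a b \<le> r + e"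
    and B: "\<And>b e. b \<in> B \<Longrightarrow> 0 < e \<Longrightarrow> \<exists>a\<in>A. d a b \<le> r + e"
  shows "hausdorff_distance d A B \<le> r"
proof -
  have "(INF b\<in>B. d a b) \<le> r" if a: "a \<in> A" for a
  proof (rule field_le_epsilon)
    fix e :: real assume "e > 0"
    then obtain b where "b \<in> B" "d a b \<le> r + e" using A[OF a] by blast
    then show "(INF b\<in>B. d a b) \<le> r + e"
      using d a by (intro cINF_lower2) (auto intro!: bdd_belowI[of _ 0])
  qed
  moreover have "(INF a\<in>A. d a b) \<le> r" if b: "b \<in> B" for b
  proof (rule field_le_epsilon)
    fix e :: real assume "e > 0"
    then obtain a where "a \<in> A" "d a b \<le> r + e" using B[OF b] by blast
    then show "(INF a\<in>A. d a b) \<le> r + e"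
      using d b by (intro cINF_lower2) (auto intro!: bdd_belowI[of _ 0])
  qed
  ultimately show ?thesis
    using assms(1,2) by (auto simp: hausdorff_distance_def intro!: cSUP_least)
qed

section \<open>Ky Fan distance and mean distance\<close>

lemma ky_fan_bounds:
  assumes "prob_space M"
  shows "0 \<le> ky_fan M u v" "ky_fan M u v \<le> 1"
proof -
  interpret prob_space M by fact
  let ?S = "{\<epsilon>. 0 \<le> \<epsilon> \<and> prob {z \<in> space M. \<bar>u z - v z\<bar> > \<epsilon>} \<le> \<epsilon>}"
  have 1: "1 \<in> ?S" by simp
  have bdd: "bdd_below ?S" by (rule bdd_belowI[of _ 0]) simp
  show "0 \<le> ky_fan M u v"
    unfolding ky_fan_def by (rule cInf_greatest) (use 1 in blast, simp)
  show "ky_fan M u v \<le> 1"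
    unfolding ky_fan_def by (rule cInf_lower[OF 1 bdd])
qed

lemma ky_fan_commute: "ky_fan M u v = ky_fan M v u"
  by (simp add: ky_fan_def abs_minus_commute)

lemma L1_dist_commute: "L1_dist M u v = L1_dist M v u"
  by (simp add: L1_dist_def abs_minus_commute)

lemma L1_dist_nonneg: "0 \<le> L1_dist M u v"
  by (simp add: L1_dist_def)

lemma L1_dist_le:
  assumes "prob_space M" "\<And>z. z \<in> space M \<Longrightarrow> \<bar>u z - v z\<bar> \<le> c" "0 \<le> c"
  shows "L1_dist M u v \<le> c"
proof (cases "integrable M (\<lambda>z. \<bar>u z - v z\<bar>)")
  case True
  interpret prob_space M by fact
  show ?thesis
    unfolding L1_dist_def using assms by (intro integral_le_const True AE_I2) auto
next
  \<comment> \<open>The integral of a non-integrable function is 0 by convention.\<close>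
  case False
  then show ?thesis using \<open>0 \<le> c\<close> by (simp add: L1_dist_def not_integrable_integral_eq)
qed

text \<open>Read as \<open>r * 1 + (1 - r) * (r / 2)\<close>: a difference of at most 1 on mass
  \<open>r\<close> and of at most \<open>r / 2\<close> on the rest.\<close>

definition conc_bound :: "real \<Rightarrow> real" where
  "conc_bound r = (3 * r - r\<^sup>2) / 2"

lemma conc_bound_diff: "conc_bound s - conc_bound r = (s - r) * (3 - s - r) / 2"
  by (simp add: conc_bound_def power2_eq_square algebra_simps diff_divide_distrib add_divide_distrib)

text \<open>By the factorization of the difference, the slope of \<open>conc_bound\<close> on the
  unit interval lies between 1/2 and 3/2. Monotonicity and the Lipschitz estimate are merged here,
  so that \<open>e\<close> can absorb infima that are not attained.\<close>

lemma conc_bound_le_add: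
  assumes "0 \<le> r" "r \<le> 1" "0 \<le> s" "s \<le> 1" "s \<le> r + e" "0 \<le> e"
  shows "conc_bound s \<le> conc_bound r + 3 / 2 * e"
proof (cases "s \<le> r")
  case True
  then have "(s - r) * (3 - s - r) \<le> 0"
    using assms by (intro mult_nonpos_nonneg) auto
  then show ?thesis using conc_bound_diff[of s r] \<open>0 \<le> e\<close> by linarith
next
  case False
  then have "(s - r) * (3 - s - r) \<le> e * 3"
    using assms by (intro mult_mono) auto
  then show ?thesis using conc_bound_diff[of s r] by linarith
qed

lemma L1_tau_le_ky_fan:
  assumes "prob_space M" and [measurable]: "u \<in> borel_measurable M" "v \<in> borel_measurable M"
  shows "L1_dist M (tau \<circ> u) (tau \<circ> v) \<le> conc_bound (ky_fan M u v)"
proof -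
  interpret prob_space M by fact
  define S where "S = {\<epsilon>. 0 \<le> \<epsilon> \<and> prob {z \<in> space M. \<bar>u z - v z\<bar> > \<epsilon>} \<le> \<epsilon>}"
  have le1: "\<bar>tau a - tau b\<bar> \<le> 1" for a b
    using abs_tau_le[of a] abs_tau_le[of b] by linarith
  have bound: "L1_dist M (tau \<circ> u) (tau \<circ> v) \<le> conc_bound \<epsilon>" if \<epsilon>: "\<epsilon> \<in> S" "\<epsilon> \<le> 1" for \<epsilon>
  proof -
    let ?E = "{z \<in> space M. \<bar>u z - v z\<bar> > \<epsilon>}"
    have int: "integrable M (\<lambda>z. (1 - \<epsilon> / 2) * indicat_real ?E z)"
      by (intro integrable_mult_right integrable_const_bound[of _ 1]) (auto simp: indicator_def)
    \<comment> \<open>Off \<open>?E\<close> the Lipschitz bound gives \<open>\<epsilon> / 2\<close>;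
      on \<open>?E\<close> the two summands add up to the trivial bound 1.\<close>
    have "L1_dist M (tau \<circ> u) (tau \<circ> v) \<le> (\<integral>z. \<epsilon> / 2 + (1 - \<epsilon> / 2) * indicat_real ?E z \<partial>M)"
      unfolding L1_dist_def
    proof (rule integral_mono)
      show "integrable M (\<lambda>z. \<bar>(tau \<circ> u) z - (tau \<circ> v) z\<bar>)"
        by (rule integrable_const_bound[of _ 1]) (use le1 in auto)
      show "integrable M (\<lambda>z. \<epsilon> / 2 + (1 - \<epsilon> / 2) * indicat_real ?E z)"
        using int by simp
      show "\<bar>(tau \<circ> u) z - (tau \<circ> v) z\<bar> \<le> \<epsilon> / 2 + (1 - \<epsilon> / 2) * indicat_real ?E z"
        if "z \<in> space M" for z
        using le1[of "u z" "v z"] tau_lipschitz[of "u z" "v z"] that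
        by (cases "z \<in> ?E") auto
    qed
    also have "\<dots> = \<epsilon> / 2 + (1 - \<epsilon> / 2) * prob ?E"
      using int by (subst Bochner_Integration.integral_add) (simp_all add: prob_space Int_def conj_ac)
    also have "\<dots> \<le> \<epsilon> / 2 + (1 - \<epsilon> / 2) * \<epsilon>"
      using \<epsilon> by (intro add_left_mono mult_left_mono) (auto simp: S_def)
    also have "\<dots> = conc_bound \<epsilon>"
      by (simp add: conc_bound_def field_simps power2_eq_square)
    finally show ?thesis .
  qed
  let ?k = "ky_fan M u v"
  have k: "0 \<le> ?k" "?k \<le> 1" by (rule ky_fan_bounds[OF assms(1)])+
  have "1 \<in> S" by (simp add: S_def)
  show ?thesis
  proof (rule field_le_epsilon)
    fix e :: real assume "e > 0"
    \<comment> \<open>The factor 2/3 cancels the slope 3/2 of \<open>conc_bound\<close>.\<close>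
    then have "Inf S < ?k + 2 / 3 * e" by (simp add: ky_fan_def S_def)
    then obtain s where s: "s \<in> S" "s < ?k + 2 / 3 * e"
      using cInf_lessD[of S] \<open>1 \<in> S\<close> by blast
    \<comment> \<open>Capping at 1 keeps the level admissible and in the range covered by
      \<open>conc_bound_le_add\<close>.\<close>
    then have m: "min s 1 \<in> S" using \<open>1 \<in> S\<close> by (simp add: min_def)
    have "conc_bound (min s 1) \<le> conc_bound ?k + 3 / 2 * (2 / 3 * e)"
      using s k \<open>e > 0\<close> by (intro conc_bound_le_add) (auto simp: S_def)
    with bound[OF m] show "L1_dist M (tau \<circ> u) (tau \<circ> v) \<le> conc_bound ?k + e" by simp
  qed
qed

section \<open>Couplings as joint laws of two parameters\<close>

definition parameter_coupling ::
    "'a data_set \<Rightarrow> 'b data_set \<Rightarrow> (real \<Rightarrow> 'a) \<Rightarrow> (real \<Rightarrow> 'b) \<Rightarrow> ('a \<times> 'b) measure" where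
  "parameter_coupling X Y \<phi> \<psi> =
     distr unit_lebesgue (borel_of (prod_topology (feat_topology X) (feat_topology Y)))
       (\<lambda>t. (\<phi> t, \<psi> t))"

text \<open>Approximate \<open>u\<close> in mean by some \<open>tau \<circ> f\<close>, replace
  \<open>f\<close> by a feature \<open>g\<close> of \<open>Y\<close> that is close in the Ky Fan
  metric, and apply \<open>L1_tau_le_ky_fan\<close>. Only one side of the Hausdorff distance enters,
  so exchanging the two data sets yields the other side.\<close>

lemma K_tau_parameter_approx:
  assumes X: "geometric_data_set X" and Y: "geometric_data_set Y"
    and \<phi>: "\<phi> \<in> parameters X" and \<psi>: "\<psi> \<in> parameters Y"
    and \<delta>: "\<And>f. f \<in> feats X \<Longrightarrow> (INF g\<in>feats Y. ky_fan unit_lebesgue (f \<circ> \<phi>) (g \<circ> \<psi>)) \<le> \<delta>"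
    and "0 \<le> \<delta>" "\<delta> \<le> 1" and u: "u \<in> K_tau X" and "0 < e"
  shows "\<exists>v\<in>K_tau Y. L1_dist unit_lebesgue (u \<circ> \<phi>) (v \<circ> \<psi>) \<le> conc_bound \<delta> + e"
proof -
  interpret prob_space unit_lebesgue by (rule prob_space_unit_lebesgue)
  have \<phi>m[measurable]: "\<phi> \<in> measurable unit_lebesgue (meas X)"
    and \<phi>d: "distr unit_lebesgue (meas X) \<phi> = meas X"
    using \<phi> by (auto simp: parameters_def)
  have \<psi>m[measurable]: "\<psi> \<in> measurable unit_lebesgue (meas Y)"
    using \<psi> by (auto simp: parameters_def)
  have \<phi>s: "\<phi> t \<in> pts X" and \<psi>s: "\<psi> t \<in> pts Y" if "t \<in> {0..<1}" for t
    using measurable_space[OF \<phi>m, of t] measurable_space[OF \<psi>m, of t] that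
      space_meas[OF X] space_meas[OF Y] by auto
  \<comment> \<open>The error budget is \<open>e / 4\<close> for the approximation in mean and 3/2
    times \<open>e / 4\<close> for the slack in the choice of \<open>g\<close>, together below
    \<open>e\<close>.\<close>
  obtain f where f: "f \<in> feats X" "(\<integral>x. \<bar>u x - tau (f x)\<bar> \<partial>meas X) \<le> e / 4"
    using K_tau_L1_approx[OF X u, of "e / 4"] \<open>0 < e\<close> by auto
  have "(INF g\<in>feats Y. ky_fan unit_lebesgue (f \<circ> \<phi>) (g \<circ> \<psi>)) < \<delta> + e / 4"
    using \<delta>[OF f(1)] \<open>0 < e\<close> by simp
  moreover have "feats Y \<noteq> {}" using Y by (simp add: geometric_data_set_def)
  ultimately obtain g where g: "g \<in> feats Y"
    and k: "ky_fan unit_lebesgue (f \<circ> \<phi>) (g \<circ> \<psi>) < \<delta> + e / 4"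
    using cInf_lessD[of "(\<lambda>g. ky_fan unit_lebesgue (f \<circ> \<phi>) (g \<circ> \<psi>)) ` feats Y"] by blast
  define v where "v = restrict (tau \<circ> g) (pts Y)"
  have v: "v \<in> K_tau Y" unfolding v_def by (rule tau_feat_in_K_tau[OF Y g])
  have [measurable]: "u \<in> borel_measurable (meas X)" "f \<in> borel_measurable (meas X)"
    "g \<in> borel_measurable (meas Y)"
    using measurable_K_tau[OF X u] measurable_feat[OF X f(1)] measurable_feat[OF Y g] by auto
  have le1: "\<bar>a - b\<bar> \<le> 1" if "\<bar>a\<bar> \<le> 1 / 2" "\<bar>b\<bar> \<le> 1 / 2" for a b :: real
    using that by linarith
  have int1: "integrable unit_lebesgue (\<lambda>t. \<bar>u (\<phi> t) - tau (f (\<phi> t))\<bar>)"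
    by (rule integrable_const_bound[of _ 1])
       (use le1 K_tau_abs_le[OF X u] abs_tau_le \<phi>s in auto)
  have int2: "integrable unit_lebesgue (\<lambda>t. \<bar>tau (f (\<phi> t)) - tau (g (\<psi> t))\<bar>)"
    by (rule integrable_const_bound[of _ 1]) (use le1 abs_tau_le in auto)
  have int3: "integrable unit_lebesgue (\<lambda>t. \<bar>u (\<phi> t) - tau (g (\<psi> t))\<bar>)"
    by (rule integrable_const_bound[of _ 1])
       (use le1 K_tau_abs_le[OF X u] abs_tau_le \<phi>s in auto)
  have "L1_dist unit_lebesgue (u \<circ> \<phi>) (v \<circ> \<psi>) = (\<integral>t. \<bar>u (\<phi> t) - tau (g (\<psi> t))\<bar> \<partial>unit_lebesgue)"
    unfolding L1_dist_def by (intro Bochner_Integration.integral_cong) (auto simp: v_def \<psi>s)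
  also have "\<dots> \<le> (\<integral>t. \<bar>u (\<phi> t) - tau (f (\<phi> t))\<bar> + \<bar>tau (f (\<phi> t)) - tau (g (\<psi> t))\<bar> \<partial>unit_lebesgue)"
    by (intro integral_mono int3 Bochner_Integration.integrable_add int1 int2) auto
  also have "\<dots> = (\<integral>t. \<bar>u (\<phi> t) - tau (f (\<phi> t))\<bar> \<partial>unit_lebesgue)
      + L1_dist unit_lebesgue (tau \<circ> (f \<circ> \<phi>)) (tau \<circ> (g \<circ> \<psi>))"
    by (simp add: Bochner_Integration.integral_add[OF int1 int2] L1_dist_def)
  also have "(\<integral>t. \<bar>u (\<phi> t) - tau (f (\<phi> t))\<bar> \<partial>unit_lebesgue) = (\<integral>x. \<bar>u x - tau (f x)\<bar> \<partial>meas X)"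
    using integral_distr[OF \<phi>m, of "\<lambda>x. \<bar>u x - tau (f x)\<bar>"] by (simp add: \<phi>d)
  also have "L1_dist unit_lebesgue (tau \<circ> (f \<circ> \<phi>)) (tau \<circ> (g \<circ> \<psi>))
      \<le> conc_bound (ky_fan unit_lebesgue (f \<circ> \<phi>) (g \<circ> \<psi>))"
    by (rule L1_tau_le_ky_fan[OF prob_space_unit_lebesgue]) simp_all
  also have "\<dots> \<le> conc_bound \<delta> + 3 / 2 * (e / 4)"
    using k \<open>0 < e\<close> \<open>0 \<le> \<delta>\<close> \<open>\<delta> \<le> 1\<close> ky_fan_bounds[OF prob_space_unit_lebesgue]
    by (intro conc_bound_le_add) auto
  finally have "L1_dist unit_lebesgue (u \<circ> \<phi>) (v \<circ> \<psi>)
      \<le> (\<integral>x. \<bar>u x - tau (f x)\<bar> \<partial>meas X) + (conc_bound \<delta> + 3 / 2 * (e / 4))"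
    by (simp add: o_def)
  also have "\<dots> \<le> conc_bound \<delta> + e" using f(2) \<open>0 < e\<close> by simp
  finally show ?thesis using v by blast
qed

context
  fixes X :: "'a data_set" and Y :: "'b data_set"
  assumes X: "geometric_data_set X" and Y: "geometric_data_set Y"
begin

context
  fixes \<phi> \<psi>
  assumes \<phi>: "\<phi> \<in> parameters X" and \<psi>: "\<psi> \<in> parameters Y"
begin

private lemma pair_measurable:
  "(\<lambda>t. (\<phi> t, \<psi> t)) \<in> measurable unit_lebesgue
     (borel_of (prod_topology (feat_topology X) (feat_topology Y)))"
  using \<phi> \<psi>
  by (intro measurable_Pair_prod_topology[where S = "feat_topology X" and T = "feat_topology Y"
        and P = "meas X" and Q = "meas Y"])
     (auto simp: parameters_def space_meas X Y sets_meas[OF X] sets_meas[OF Y]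
        topspace_feat_topology second_countable_feat_topology)

lemma parameter_coupling_in_couplings: "parameter_coupling X Y \<phi> \<psi> \<in> couplings X Y"
proof -
  let ?T = "prod_topology (feat_topology X) (feat_topology Y)"
  have fst: "fst \<in> measurable (borel_of ?T) (meas X)"
    by (rule continuous_map_measurable[where S = ?T and T = "feat_topology X"])
       (auto simp: continuous_map_fst space_meas X sets_meas[OF X] topspace_feat_topology)
  have snd: "snd \<in> measurable (borel_of ?T) (meas Y)"
    by (rule continuous_map_measurable[where S = ?T and T = "feat_topology Y"])
       (auto simp: continuous_map_snd space_meas Y sets_meas[OF Y] topspace_feat_topology)
  have "prob_space (parameter_coupling X Y \<phi> \<psi>)"
    unfolding parameter_coupling_def
    by (rule prob_space.prob_space_distr[OF prob_space_unit_lebesgue pair_measurable])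
  then show ?thesis
    using \<phi> \<psi>
    by (simp add: couplings_def parameter_coupling_def topspace_feat_topology X Y
          distr_distr[OF fst pair_measurable] distr_distr[OF snd pair_measurable]
          parameters_def o_def)
qed

lemma L1_dist_parameter_coupling:
  assumes u: "u \<in> K_tau X" and v: "v \<in> K_tau Y"
  shows "L1_dist (parameter_coupling X Y \<phi> \<psi>) (u \<circ> fst) (v \<circ> snd)
    = L1_dist unit_lebesgue (u \<circ> \<phi>) (v \<circ> \<psi>)"
proof -
  let ?T = "prod_topology (feat_topology X) (feat_topology Y)"
  have [measurable]: "u \<circ> fst \<in> borel_measurable (borel_of ?T)"
    by (rule continuous_map_borel_measurable[OF
          continuous_map_compose[OF continuous_map_fst continuous_map_K_tau[OF X u]]]) auto
  have [measurable]: "v \<circ> snd \<in> borel_measurable (borel_of ?T)"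
    by (rule continuous_map_borel_measurable[OF
          continuous_map_compose[OF continuous_map_snd continuous_map_K_tau[OF Y v]]]) auto
  have "(\<lambda>z. \<bar>(u \<circ> fst) z - (v \<circ> snd) z\<bar>) \<in> borel_measurable (borel_of ?T)" by measurable
  then show ?thesis
    unfolding L1_dist_def parameter_coupling_def
    by (subst integral_distr[OF pair_measurable]) auto
qed

text \<open>The comparison already holds for each fixed pair of parameters; the infima over
  parameters and couplings enter only afterwards.\<close>

lemma D_tau_parameter_coupling_le:
  defines "\<delta> \<equiv> hausdorff_distance (ky_fan unit_lebesgue)
          ((\<lambda>f. f \<circ> \<phi>) ` feats X) ((\<lambda>g. g \<circ> \<psi>) ` feats Y)"
  shows "0 \<le> \<delta>" "\<delta> \<le> 1" "D_tau (parameter_coupling X Y \<phi> \<psi>) X Y \<le> conc_bound \<delta>"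
proof -
  have ne: "feats X \<noteq> {}" "feats Y \<noteq> {}"
    using X Y by (simp_all add: geometric_data_set_def)
  note H = hausdorff_distance_bounds[of "(\<lambda>f. f \<circ> \<phi>) ` feats X" "(\<lambda>g. g \<circ> \<psi>) ` feats Y"
      "ky_fan unit_lebesgue" 1, folded \<delta>_def]
  show \<delta>: "0 \<le> \<delta>" "\<delta> \<le> 1"
    by (rule H(1,2); use ne ky_fan_bounds[OF prob_space_unit_lebesgue] in auto)+
  have A: "(INF g\<in>feats Y. ky_fan unit_lebesgue (f \<circ> \<phi>) (g \<circ> \<psi>)) \<le> \<delta>" if "f \<in> feats X" for f
    using H(3)[of "f \<circ> \<phi>"] ne ky_fan_bounds[OF prob_space_unit_lebesgue] that
    by (auto simp: image_image)
  \<comment> \<open>Symmetry of the Ky Fan metric brings this side into the form of \<open>A\<close>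
    with the data sets exchanged.\<close>
  have B: "(INF f\<in>feats X. ky_fan unit_lebesgue (g \<circ> \<psi>) (f \<circ> \<phi>)) \<le> \<delta>" if "g \<in> feats Y" for g
    using H(4)[of "g \<circ> \<psi>"] ne ky_fan_bounds[OF prob_space_unit_lebesgue] that
    by (auto simp: image_image ky_fan_commute[of _ "g \<circ> \<psi>"])
  show "D_tau (parameter_coupling X Y \<phi> \<psi>) X Y \<le> conc_bound \<delta>"
    unfolding D_tau_def
  proof (rule hausdorff_distance_le)
    fix a :: "'a \<times> 'b \<Rightarrow> real" and e :: real assume "a \<in> (\<lambda>k. k \<circ> fst) ` K_tau X" "0 < e"
    then obtain u where u: "u \<in> K_tau X" "a = u \<circ> fst" by blast
    obtain v where "v \<in> K_tau Y" "L1_dist unit_lebesgue (u \<circ> \<phi>) (v \<circ> \<psi>) \<le> conc_bound \<delta> + e"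
      using K_tau_parameter_approx[OF X Y \<phi> \<psi> A \<delta> u(1) \<open>0 < e\<close>] by blast
    then show "\<exists>b\<in>(\<lambda>k. k \<circ> snd) ` K_tau Y.
        L1_dist (parameter_coupling X Y \<phi> \<psi>) a b \<le> conc_bound \<delta> + e"
      using u L1_dist_parameter_coupling by auto
  next
    fix b :: "'a \<times> 'b \<Rightarrow> real" and e :: real assume "b \<in> (\<lambda>k. k \<circ> snd) ` K_tau Y" "0 < e"
    then obtain v where v: "v \<in> K_tau Y" "b = v \<circ> snd" by blast
    obtain u where "u \<in> K_tau X" "L1_dist unit_lebesgue (v \<circ> \<psi>) (u \<circ> \<phi>) \<le> conc_bound \<delta> + e"
      using K_tau_parameter_approx[OF Y X \<psi> \<phi> B \<delta> v(1) \<open>0 < e\<close>] by blast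
    then show "\<exists>a\<in>(\<lambda>k. k \<circ> fst) ` K_tau X.
        L1_dist (parameter_coupling X Y \<phi> \<psi>) a b \<le> conc_bound \<delta> + e"
      using v L1_dist_parameter_coupling L1_dist_commute[of unit_lebesgue] by auto
  qed (auto simp: L1_dist_nonneg K_tau_nonempty X Y)
qed

end

lemma couplings_nonempty: "couplings X Y \<noteq> {}"
  using parameter_coupling_in_couplings parameters_nonempty[OF X] parameters_nonempty[OF Y] by blast

text \<open>Elements of \<open>K_tau\<close> take values in an interval of length 1, so all mean
  distances are at most 1 and the suprema in the Hausdorff distance are genuine. The result also
  bounds the infimum in \<open>d_tau\<close> from below.\<close>

lemma D_tau_nonneg:
  assumes "\<pi> \<in> couplings X Y"
  shows "0 \<le> D_tau \<pi> X Y"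
  unfolding D_tau_def
proof (rule hausdorff_distance_bounds(1)[where c = 1])
  fix a b :: "'a \<times> 'b \<Rightarrow> real" assume "a \<in> (\<lambda>k. k \<circ> fst) ` K_tau X" "b \<in> (\<lambda>k. k \<circ> snd) ` K_tau Y"
  then obtain u v where uv: "u \<in> K_tau X" "v \<in> K_tau Y" "a = u \<circ> fst" "b = v \<circ> snd" by blast
  have "\<bar>a z - b z\<bar> \<le> 1" if "z \<in> space \<pi>" for z
  proof -
    have z: "fst z \<in> pts X" "snd z \<in> pts Y"
      using that assms by (auto simp: couplings_def)
    show ?thesis
      using K_tau_abs_le[OF X uv(1) z(1)] K_tau_abs_le[OF Y uv(2) z(2)]
      by (simp add: uv(3,4))
  qed
  moreover have "prob_space \<pi>" using assms by (simp add: couplings_def)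
  ultimately show "0 \<le> L1_dist \<pi> a b \<and> L1_dist \<pi> a b \<le> 1"
    by (intro conjI L1_dist_nonneg L1_dist_le) auto
qed (auto simp: K_tau_nonempty X Y)

lemma d_tau_nonneg: "0 \<le> d_tau X Y"
  unfolding d_tau_def using couplings_nonempty D_tau_nonneg by (rule cINF_greatest)

lemma d_tau_le_D_tau: "\<pi> \<in> couplings X Y \<Longrightarrow> d_tau X Y \<le> D_tau \<pi> X Y"
  unfolding d_tau_def using D_tau_nonneg by (intro cINF_lower) (auto intro!: bdd_belowI[of _ 0])

text \<open>A nearly optimal pair of parameters induces a competitor for \<open>d_tau\<close>, and
  the slope bound on \<open>conc_bound\<close> controls the loss; hence the factor 2/3 in the choice
  of that pair.\<close>

lemma d_conc_bounds: "0 \<le> d_conc X Y" "d_conc X Y \<le> 1"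
  and d_tau_le_conc_bound: "d_tau X Y \<le> conc_bound (d_conc X Y)"
proof -
  define h where "h = (\<lambda>(\<phi>, \<psi>). hausdorff_distance (ky_fan unit_lebesgue)
          ((\<lambda>f. f \<circ> \<phi>) ` feats X) ((\<lambda>g. g \<circ> \<psi>) ` feats Y))"
  let ?P = "parameters X \<times> parameters Y"
  have dc: "d_conc X Y = Inf (h ` ?P)"
    by (simp add: d_conc_def h_def)
  have ne: "h ` ?P \<noteq> {}"
    using parameters_nonempty[OF X] parameters_nonempty[OF Y] by auto
  have h01: "0 \<le> h p" "h p \<le> 1" if "p \<in> ?P" for p
    using that D_tau_parameter_coupling_le(1,2) by (auto simp: h_def)
  have bdd: "bdd_below (h ` ?P)" using h01 by (auto intro!: bdd_belowI[of _ 0])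
  show 0: "0 \<le> d_conc X Y"
    unfolding dc using ne h01 by (intro cInf_greatest) auto
  obtain p where "p \<in> ?P" using ne by auto
  then show 1: "d_conc X Y \<le> 1"
    unfolding dc using h01(2) by (intro cInf_lower2[of "h p"] bdd) auto
  show "d_tau X Y \<le> conc_bound (d_conc X Y)"
  proof (rule field_le_epsilon)
    fix e :: real assume "e > 0"
    then have "Inf (h ` ?P) < d_conc X Y + 2 / 3 * e" by (simp add: dc)
    from cInf_lessD[OF ne this]
    obtain \<phi> \<psi> where p: "\<phi> \<in> parameters X" "\<psi> \<in> parameters Y"
      and hp: "h (\<phi>, \<psi>) < d_conc X Y + 2 / 3 * e"
      by blast
    have "d_tau X Y \<le> D_tau (parameter_coupling X Y \<phi> \<psi>) X Y"
      by (rule d_tau_le_D_tau[OF parameter_coupling_in_couplings[OF p]])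
    also have "\<dots> \<le> conc_bound (h (\<phi>, \<psi>))"
      using D_tau_parameter_coupling_le(3)[OF p] by (simp add: h_def)
    also have "\<dots> \<le> conc_bound (d_conc X Y) + 3 / 2 * (2 / 3 * e)"
      using p h01[of "(\<phi>, \<psi>)"] 0 1 hp \<open>e > 0\<close> by (intro conc_bound_le_add) auto
    finally show "d_tau X Y \<le> conc_bound (d_conc X Y) + e" by simp
  qed
qed

end

section \<open>One-point spaces\<close>

text \<open>The metric does not see \<open>c\<close>, but the feature does: features are compared by
  value, not up to additive constants.\<close>

definition point_data_set :: "real \<Rightarrow> real data_set" where
  "point_data_set c = \<lparr>pts = {0}, feats = {restrict (\<lambda>_. c) {0}}, meas = count_space {0}\<rparr>"

lemma feat_dist_point_data_set: "feat_dist (point_data_set c) = (\<lambda>_ _. 0)"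
  by (intro ext) (simp add: feat_dist_def point_data_set_def)

lemma geometric_point_data_set: "geometric_data_set (point_data_set c)"
proof -
  define d :: "real \<Rightarrow> real \<Rightarrow> real" where "d = (\<lambda>_ _. 0)"
  interpret Metric_space "{0::real}" d
    by (rule Metric_space.intro) (auto simp: d_def)
  have op: "openin mtopology U \<longleftrightarrow> U \<subseteq> {0}" for U
  proof
    assume "U \<subseteq> {0}"
    then have "mball x 1 \<subseteq> U" if "x \<in> U" for x
      using that by auto
    with \<open>U \<subseteq> {0}\<close> show "openin mtopology U"
      unfolding openin_mtopology using zero_less_one by blast
  qed (simp add: openin_mtopology)
  have T: "feat_topology (point_data_set c) = mtopology"
    unfolding feat_topology_def feat_dist_point_data_set d_def by (simp add: point_data_set_def)
  have "mcomplete"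
    unfolding mcomplete_def
  proof (intro allI impI exI)
    fix \<sigma> :: "nat \<Rightarrow> real" assume "MCauchy \<sigma>"
    then have "\<sigma> n \<in> {0}" for n by (auto simp: MCauchy_def)
    then show "limitin mtopology \<sigma> 0 sequentially"
      unfolding limitin_metric by (simp add: d_def)
  qed
  moreover have "separable_space mtopology"
    unfolding separable_space_def using closure_of_topspace[of mtopology]
    by (intro exI[of _ "{0}"]) simp
  moreover have "sets (borel_of mtopology) = Pow {0}"
  proof -
    have "{U. openin mtopology U} = Pow {0}" using op by auto
    then show ?thesis using sigma_algebra.sigma_sets_eq[OF sigma_algebra_Pow, of "{0::real}"] by simp
  qed
  moreover have "prob_space (count_space {0::real})"
    by (rule prob_spaceI) simp
  moreover have "emeasure (count_space {0}) U > 0" if "openin mtopology U" "U \<noteq> {}" for U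
  proof -
    have "U = {0}" using that op by auto
    then show ?thesis by simp
  qed
  ultimately show ?thesis
    using Metric_space_axioms
    unfolding geometric_data_set_def T feat_dist_point_data_set d_def[symmetric]
    by (auto simp: point_data_set_def)
qed

text \<open>The product topology is T1, so a singleton is closed and the closure adds
  nothing.\<close>

lemma K_tau_point_data_set: "K_tau (point_data_set c) = {restrict (\<lambda>_. tau c) {0}}"
proof -
  have "(\<lambda>f. restrict (tau \<circ> f) {0}) ` {restrict (\<lambda>_. c) {0}} = {restrict (\<lambda>_. tau c) {0::real}}"
    by (auto simp: restrict_def fun_eq_iff)
  then show ?thesis
    unfolding K_tau_def pointwise_closure_def
    by (simp add: point_data_set_def closure_of_singleton t1_space_product_topology
          t1_space_euclidean)
qed

text \<open>Every coupling sits on one point, where the integrand is constant; the infimum is that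
  of a constant over a nonempty set.\<close>

lemma d_tau_point_data_set: "d_tau (point_data_set a) (point_data_set b) = \<bar>tau a - tau b\<bar>"
proof -
  have "D_tau \<pi> (point_data_set a) (point_data_set b) = \<bar>tau a - tau b\<bar>"
    if "\<pi> \<in> couplings (point_data_set a) (point_data_set b)" for \<pi>
  proof -
    have \<pi>: "prob_space \<pi>" "space \<pi> = {(0, 0)}"
      using that by (auto simp: couplings_def point_data_set_def)
    have "L1_dist \<pi> (restrict (\<lambda>_. tau a) {0} \<circ> fst) (restrict (\<lambda>_. tau b) {0} \<circ> snd)
        = (\<integral>z. \<bar>tau a - tau b\<bar> \<partial>\<pi>)"
      unfolding L1_dist_def by (intro Bochner_Integration.integral_cong) (auto simp: \<pi>)
    also have "\<dots> = \<bar>tau a - tau b\<bar>"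
      using prob_space.prob_space[OF \<pi>(1)] by simp
    finally show ?thesis
      by (simp add: D_tau_def hausdorff_distance_def K_tau_point_data_set)
  qed
  then show ?thesis
    unfolding d_tau_def
    using couplings_nonempty[OF geometric_point_data_set geometric_point_data_set] by simp
qed

text \<open>Whatever the parameters, the composed features differ by exactly 1 everywhere. The set
  where the difference exceeds \<open>\<epsilon>\<close> is everything for
  \<open>\<epsilon> < 1\<close> and, the inequality being strict, empty from 1 on, so the admissible
  levels form \<open>{1..}\<close>.\<close>

lemma d_conc_point_data_set:
  assumes "\<bar>a - b\<bar> = 1"
  shows "d_conc (point_data_set a) (point_data_set b) = 1"
proof -
  have "hausdorff_distance (ky_fan unit_lebesgue)
          ((\<lambda>f. f \<circ> \<phi>) ` feats (point_data_set a)) ((\<lambda>g. g \<circ> \<psi>) ` feats (point_data_set b)) = 1"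
    if "\<phi> \<in> parameters (point_data_set a)" "\<psi> \<in> parameters (point_data_set b)" for \<phi> \<psi>
  proof -
    interpret prob_space unit_lebesgue by (rule prob_space_unit_lebesgue)
    have 0: "\<phi> t = 0" "\<psi> t = 0" if "t \<in> {0..<1}" for t
      using measurable_space[of \<phi> unit_lebesgue "count_space {0}" t]
        measurable_space[of \<psi> unit_lebesgue "count_space {0}" t] that
        \<open>\<phi> \<in> parameters _\<close> \<open>\<psi> \<in> parameters _\<close>
      by (auto simp: parameters_def point_data_set_def)
    let ?E = "\<lambda>\<epsilon>. {t \<in> {0..<1}. \<bar>(restrict (\<lambda>_. a) {0} \<circ> \<phi>) t - (restrict (\<lambda>_. b) {0} \<circ> \<psi>) t\<bar> > \<epsilon>}"
    have E: "?E \<epsilon> = (if \<epsilon> < 1 then {0..<1} else {})" for \<epsilon>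
      using assms 0 by auto
    have "{\<epsilon>. 0 \<le> \<epsilon> \<and> prob (?E \<epsilon>) \<le> \<epsilon>} = {1..}"
      unfolding E using prob_space by auto
    then have "ky_fan unit_lebesgue (restrict (\<lambda>_. a) {0} \<circ> \<phi>) (restrict (\<lambda>_. b) {0} \<circ> \<psi>) = 1"
      unfolding ky_fan_def by simp
    then show ?thesis
      by (simp add: hausdorff_distance_def point_data_set_def)
  qed
  then have "d_conc (point_data_set a) (point_data_set b) =
      (INF p\<in>parameters (point_data_set a) \<times> parameters (point_data_set b). 1)"
    unfolding d_conc_def by (intro INF_cong) auto
  then show ?thesis
    using parameters_nonempty[OF geometric_point_data_set] by simp
qed

lemma tau_gap_tendsto: "(\<lambda>n. \<bar>tau (real n) - tau (real n + 1)\<bar>) \<longlonglongrightarrow> 0"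
proof -
  have t: "(tanh \<longlongrightarrow> (1::real)) at_top" by (rule tanh_real_at_top)
  have "(\<lambda>n. tanh (real n)) \<longlonglongrightarrow> 1"
    by (rule filterlim_compose[OF t filterlim_real_sequentially])
  moreover from LIMSEQ_Suc[OF this] have "(\<lambda>n. tanh (real n + 1)) \<longlonglongrightarrow> 1"
    by (simp add: add.commute)
  ultimately have "(\<lambda>n. \<bar>tanh (real n) / 2 - tanh (real n + 1) / 2\<bar>) \<longlonglongrightarrow> \<bar>1 / 2 - 1 / 2\<bar>"
    by (intro tendsto_intros) auto
  then show ?thesis by (simp add: tau_def)
qed

section \<open>The upper estimate for all data sets and the absence of a converse modulus\<close>

theorem theorem3p10:
  shows "(\<forall>(X :: 'a data_set) (Y :: 'b data_set).
            geometric_data_set X \<and> geometric_data_set Y \<longrightarrow>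
              0 \<le> d_tau X Y \<and>
              d_tau X Y \<le> (3 * d_conc X Y - (d_conc X Y)\<^sup>2) / 2 \<and>
              (3 * d_conc X Y - (d_conc X Y)\<^sup>2) / 2 \<le> 1) \<and>
         (\<nexists>\<omega> :: real \<Rightarrow> real.
            (\<forall>r\<in>{0..1}. 0 \<le> \<omega> r) \<and>
            (\<omega> \<longlongrightarrow> 0) (at 0 within {0..1}) \<and>
            (\<forall>(X :: real data_set) (Y :: real data_set).
               geometric_data_set X \<and> geometric_data_set Y \<longrightarrow>
                 d_conc X Y \<le> \<omega> (d_tau X Y)))"
proof (intro conjI allI impI notI; (elim exE conjE)?)
  fix X :: "'a data_set" and Y :: "'b data_set"
  assume XY: "geometric_data_set X" "geometric_data_set Y"
  show "0 \<le> d_tau X Y" by (rule d_tau_nonneg[OF XY])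
  show "d_tau X Y \<le> (3 * d_conc X Y - (d_conc X Y)\<^sup>2) / 2"
    using d_tau_le_conc_bound[OF XY] by (simp add: conc_bound_def)
  \<comment> \<open>This is monotonicity of \<open>conc_bound\<close>, the case of zero slack,
    together with its value 1 at 1.\<close>
  show "(3 * d_conc X Y - (d_conc X Y)\<^sup>2) / 2 \<le> 1"
    using conc_bound_le_add[of 1 "d_conc X Y" 0] d_conc_bounds[OF XY] by (simp add: conc_bound_def)
next
  fix \<omega> :: "real \<Rightarrow> real"
  assume lim: "(\<omega> \<longlongrightarrow> 0) (at 0 within {0..1})"
    and le: "\<forall>(X :: real data_set) (Y :: real data_set).
               geometric_data_set X \<and> geometric_data_set Y \<longrightarrow> d_conc X Y \<le> \<omega> (d_tau X Y)"
  define r where "r n = \<bar>tau (real n) - tau (real n + 1)\<bar>" for n :: nat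
  \<comment> \<open>The limit at 0 disregards the value \<open>\<omega> 0\<close>, so the gaps have
    to be nonzero; this holds as \<open>tanh\<close> is injective.\<close>
  have r: "r n \<noteq> 0" "r n \<in> {0..1}" for n
  proof -
    show "r n \<noteq> 0"
      by (simp add: r_def tau_def)
    show "r n \<in> {0..1}"
      using abs_tau_le[of "real n"] abs_tau_le[of "real n + 1"]
        abs_triangle_ineq4[of "tau (real n)" "tau (real n + 1)"] unfolding r_def by auto
  qed
  have "r \<longlonglongrightarrow> 0" unfolding r_def by (rule tau_gap_tendsto)
  with r have "filterlim r (at 0 within {0..1}) sequentially"
    by (simp add: filterlim_at)
  then have "(\<lambda>n. \<omega> (r n)) \<longlonglongrightarrow> 0" by (rule filterlim_compose[OF lim])
  \<comment> \<open>The one-point spaces with constants \<open>n\<close> and \<open>n + 1\<close>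
    have observable distance 1, while \<open>r n\<close> is their compactified distance.\<close>
  moreover have "1 \<le> \<omega> (r n)" for n
    using le[rule_format, of "point_data_set (real n)" "point_data_set (real n + 1)"]
    by (simp add: geometric_point_data_set d_tau_point_data_set d_conc_point_data_set r_def)
  ultimately have "1 \<le> (0::real)"
    by (intro LIMSEQ_le_const[of "\<lambda>n. \<omega> (r n)"]) auto
  then show False by simp
qed

end
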